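(* Given any positive integer $k$, $$\overrightarrow{TR}(k) \leq \overrightarrow{R}(2k-1) + (2k-1)\,\overrightarrow{R}(k).$$
   Context: $T_k$ denotes the transitive tournament on $k$ vertices. A perfect $T_k$-packing in an oriented graph $G$ is a collection of vertex-disjoint copies of $T_k$ in $G$ which covers all the vertices of $G$. The oriented tiling Ramsey number $\overrightarrow{TR}(k)$ is the smallest positive integer $n$ divisible by $k$ such that any orientation of the complete graph $K_n$ contains a perfect $T_k$-packing. The oriented Ramsey number $\overrightarrow{R}(k)$ is the smallest positive integer $n$ such that any orientation of $K_n$ contains a copy of $T_k$. It is known that both numbers exist for every $k$. *)

theory Defs
  imports "Graph_Theory.Graph_Theory"
begin

definition oriented_graph :: "'a pair_pre_digraph \<Rightarrow> bool" where
  "oriented_graph G \<longleftrightarrow> pair_digraph G \<and> antisym (parcs G)"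

(* Undirected graphs are represented as symmetric digraphs, so mk_symmetric G is
   the underlying graph of G. *)
definition orientation_of :: "'a pair_pre_digraph \<Rightarrow> 'a pair_pre_digraph \<Rightarrow> bool" where
  "orientation_of G H \<longleftrightarrow> oriented_graph G \<and> mk_symmetric (with_proj G) = H"

definition transitive_tournament :: "nat \<Rightarrow> nat pair_pre_digraph" where
  "transitive_tournament k = \<lparr> pverts = {..<k}, parcs = {(i, j). i < j \<and> j < k} \<rparr>"

definition copy_in :: "'b pair_pre_digraph \<Rightarrow> 'a pair_pre_digraph \<Rightarrow> 'a pair_pre_digraph \<Rightarrow> bool" where
  "copy_in T H G \<longleftrightarrow>
     subgraph (with_proj H) (with_proj G) \<and> digraph_iso (with_proj T) (with_proj H)"

definition perfect_packing ::
  "'b pair_pre_digraph \<Rightarrow> 'a pair_pre_digraph set \<Rightarrow> 'a pair_pre_digraph \<Rightarrow> bool" where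
  "perfect_packing T \<P> G \<longleftrightarrow>
     (\<forall>H\<in>\<P>. copy_in T H G) \<and>
     pairwise (\<lambda>H H'. pverts H \<inter> pverts H' = {}) \<P> \<and>
     (\<Union>H\<in>\<P>. pverts H) = pverts G"

(* In the next two definitions K ranges over all complete graphs with n vertices
   taken from nat; every finite graph is isomorphic to one on such a vertex set. *)
definition oriented_tiling_Ramsey :: "nat \<Rightarrow> nat" where
  "oriented_tiling_Ramsey k = (LEAST n. 0 < n \<and> k dvd n \<and>
     (\<forall>K G :: nat pair_pre_digraph. K\<^bsub>n\<^esub> (with_proj K) \<longrightarrow> orientation_of G K \<longrightarrow>
        (\<exists>\<P>. perfect_packing (transitive_tournament k) \<P> G)))"

definition oriented_Ramsey :: "nat \<Rightarrow> nat" where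
  "oriented_Ramsey k = (LEAST n. 0 < n \<and>
     (\<forall>K G :: nat pair_pre_digraph. K\<^bsub>n\<^esub> (with_proj K) \<longrightarrow> orientation_of G K \<longrightarrow>
        (\<exists>H. copy_in (transitive_tournament k) H G)))"

end

theory Submission
  imports Defs "HOL-Library.Disjoint_Sets"
begin

text \<open>
  A transitive set \<open>A\<close> with \<open>2 * k - 1\<close> vertices absorbs any further vertex \<open>v\<close>: among the vertices
  of \<open>A\<close> there are \<open>k - 1\<close> that all dominate \<open>v\<close> or are all dominated by \<open>v\<close>; together with \<open>v\<close>
  they form a transitive set of size \<open>k\<close>, and so do the \<open>k\<close> vertices of \<open>A\<close> that are left.
  In a large tournament, first set aside \<open>R(k) - 1\<close> disjoint transitive sets of size \<open>2 * k - 1\<close>, then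
  tile the rest greedily by transitive sets of size \<open>k\<close> until fewer than \<open>R(k)\<close> vertices remain, and
  let these be absorbed. The absorbers that are not needed come in groups of \<open>k\<close> by divisibility;
  one member of a group splits into a transitive set of size \<open>k\<close> and \<open>k - 1\<close> vertices, which are
  absorbed by the other \<open>k - 1\<close> members.
\<close>

section \<open>Transitive sets in tournaments\<close>

text \<open>Here \<open>v\<close> becomes a source: by asymmetry no arc enters \<open>v\<close>, so
  the only new triples to check start at \<open>v\<close>, and \<open>v\<close> dominates their last
  vertex. The next lemma is the mirror image with a sink.\<close>

lemma trans_on_insert_dominating:
  assumes "trans_on A E" and "asym E" and "\<And>x. x \<in> A \<Longrightarrow> (v, x) \<in> E"
  shows "trans_on (insert v A) E"
  using assms unfolding trans_on_def by (blast dest: asymD)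

lemma trans_on_insert_dominated:
  assumes "trans_on A E" and "asym E" and "\<And>x. x \<in> A \<Longrightarrow> (x, v) \<in> E"
  shows "trans_on (insert v A) E"
  using assms unfolding trans_on_def by (blast dest: asymD)

lemma trans_on_insert:
  assumes "trans_on B E" and "asym E"
    and "(\<forall>x\<in>B. (v, x) \<in> E) \<or> (\<forall>x\<in>B. (x, v) \<in> E)"
  shows "trans_on (insert v B) E"
  using assms trans_on_insert_dominating[of B E v] trans_on_insert_dominated[of B E v] by blast

text \<open>Pigeonhole: each vertex of \<open>A\<close> is an out- or an in-neighbour of
  \<open>v\<close>, so one of the two kinds occurs at least \<open>n\<close> times. Both the
  existence of Ramsey numbers and the absorption of a vertex rest on this.\<close>

lemma card_large_neighbourhood:
  assumes "total_on (insert v A) E" and "v \<notin> A" and "card A = 2 * n - 1"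
    and "finite A"
  obtains N where "N \<subseteq> A" "n \<le> card N"
    "(\<forall>x\<in>N. (v, x) \<in> E) \<or> (\<forall>x\<in>N. (x, v) \<in> E)"
proof -
  have "(v, x) \<in> E \<or> (x, v) \<in> E" if "x \<in> A" for x
    using assms(1,2) that unfolding total_on_def by (metis insertCI)
  then have "A \<subseteq> {x \<in> A. (v, x) \<in> E} \<union> {x \<in> A. (x, v) \<in> E}" by auto
  then have "card A \<le> card ({x \<in> A. (v, x) \<in> E} \<union> {x \<in> A. (x, v) \<in> E})"
    using assms(4) by (intro card_mono) auto
  also have "\<dots> \<le> card {x \<in> A. (v, x) \<in> E} + card {x \<in> A. (x, v) \<in> E}"
    by (rule card_Un_le)
  finally consider "n \<le> card {x \<in> A. (v, x) \<in> E}" | "n \<le> card {x \<in> A. (x, v) \<in> E}"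
    using assms(3) by linarith
  then show thesis
    using that[of "{x \<in> A. (v, x) \<in> E}"] that[of "{x \<in> A. (x, v) \<in> E}"] by cases auto
qed

text \<open>Halving argument: fix \<open>v\<close>, keep \<open>2 ^ k\<close> vertices on one side
  of it, find a transitive \<open>k\<close>-set among them and add \<open>v\<close> as a source or
  sink. The bound serves only to show that Ramsey numbers exist.\<close>

lemma large_tournament_has_transitive_set:
  assumes "total_on V E" and "asym E" and "2 ^ k \<le> card V"
  shows "\<exists>S\<subseteq>V. card S = k \<and> trans_on S E"
  using assms
proof (induction k arbitrary: V)
  case 0
  then show ?case by (intro exI[of _ "{}"]) (auto simp: trans_on_def)
next
  case (Suc k)
  have fin: "finite V"
    using Suc.prems(3) zero_less_power[of "2::nat" "Suc k"] by (intro card_ge_0_finite) linarith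
  obtain v where v: "v \<in> V"
    using Suc.prems(3) by (metis card.empty equals0I not_one_le_zero one_le_numeral one_le_power order_trans)
  have card: "2 * 2 ^ k - 1 \<le> card (V - {v})"
    using Suc.prems(3) v fin by (simp add: card_Diff_singleton)
  then obtain A where A: "A \<subseteq> V - {v}" "card A = 2 * 2 ^ k - 1" "finite A"
    by (meson obtain_subset_with_card_n)
  have tot: "total_on (insert v A) E" using Suc.prems(1) A(1) v by (auto simp: total_on_def)
  have "v \<notin> A" using A(1) by auto
  then obtain B where B: "B \<subseteq> A" "2 ^ k \<le> card B"
    "(\<forall>x\<in>B. (v, x) \<in> E) \<or> (\<forall>x\<in>B. (x, v) \<in> E)"
    using card_large_neighbourhood[OF tot _ A(2,3)] by blast
  have "total_on B E" using tot B(1) by (auto simp: total_on_def)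
  then obtain S where S: "S \<subseteq> B" "card S = k" "trans_on S E"
    using Suc.IH Suc.prems(2) B(2) by blast
  have "trans_on (insert v S) E"
    using S B Suc.prems(2) by (intro trans_on_insert) auto
  moreover have "card (insert v S) = Suc k"
    using S B(1) A finite_subset[of S A] by (subst card_insert_disjoint) auto
  ultimately show ?case using S(1) B(1) A(1) v by (intro exI[of _ "insert v S"]) auto
qed

section \<open>Copies of transitive tournaments\<close>

text \<open>Arcs are pairs of vertices, so an injection on vertices already determines the map on
  arcs, and \<open>snd\<close> and \<open>fst\<close> remain head and tail.\<close>

lemma digraph_iso_with_projI:
  assumes "pair_wf_digraph T" and "inj_on h (pverts T)"
    and "pverts H = h ` pverts T" and "parcs H = map_prod h h ` parcs T"
  shows "digraph_iso (with_proj T) (with_proj H)"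
proof -
  interpret pair_wf_digraph T by fact
  let ?f = "\<lparr>iso_verts = h, iso_arcs = map_prod h h, iso_head = snd, iso_tail = fst\<rparr>"
  have "inj_on (map_prod h h) (parcs T)"
    using map_prod_inj_on[OF assms(2,2)] by (rule inj_on_subset) (auto dest: in_arcsD1 in_arcsD2)
  then have "pre_digraph.digraph_isomorphism (with_proj T) ?f"
    using assms(2) wf_digraph_wp_iff[of T] assms(1) by (simp add: pre_digraph.digraph_isomorphism_def)
  moreover have "with_proj H = app_iso ?f (with_proj T)"
    using assms(3,4) by (simp add: with_proj_def app_iso_def)
  ultimately show ?thesis unfolding digraph_iso_def by blast
qed

text \<open>Since the image is again of the form \<open>with_proj\<close>, its head and tail maps
  must be \<open>snd\<close> and \<open>fst\<close>; compatibility with endpoints then forces the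
  arc map to be \<open>map_prod\<close> of the vertex map.\<close>

lemma digraph_iso_with_projE:
  assumes "digraph_iso (with_proj T) (with_proj H)"
  obtains h where "inj_on h (pverts T)" "pverts H = h ` pverts T"
    "parcs H = map_prod h h ` parcs T"
proof -
  obtain f where f: "pre_digraph.digraph_isomorphism (with_proj T) f"
    and H: "with_proj H = app_iso f (with_proj T)"
    using assms unfolding digraph_iso_def by blast
  have verts: "pverts H = iso_verts f ` pverts T" and arcs: "parcs H = iso_arcs f ` parcs T"
    and tl: "iso_tail f = fst" and hd: "iso_head f = snd"
    using H by (simp_all add: with_proj_def app_iso_def)
  have "iso_arcs f a = map_prod (iso_verts f) (iso_verts f) a" if "a \<in> parcs T" for a
    using f that tl hd by (auto simp: pre_digraph.digraph_isomorphism_def prod_eq_iff)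
  then have "parcs H = map_prod (iso_verts f) (iso_verts f) ` parcs T"
    using arcs by (metis image_cong)
  moreover have "inj_on (iso_verts f) (pverts T)"
    using f by (simp add: pre_digraph.digraph_isomorphism_def)
  ultimately show thesis using verts that by blast
qed

text \<open>In a transitive tournament the in-degrees within \<open>S\<close> are 0, ...,
  \<open>card S - 1\<close>, each taken once; the enumeration is the inverse of the in-degree map
  \<open>rank\<close>.\<close>

lemma transitive_set_enumeration:
  assumes "finite S" and "trans_on S E" and "asym E" and "total_on S E"
  obtains h where "bij_betw h {..<card S} S"
    "\<And>i j. i < card S \<Longrightarrow> j < card S \<Longrightarrow> (h i, h j) \<in> E \<longleftrightarrow> i < j"
proof -
  define rank where "rank x = card {y \<in> S. (y, x) \<in> E}" for x
  have mono: "rank x < rank y" if "x \<in> S" "y \<in> S" "(x, y) \<in> E" for x y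
    unfolding rank_def
  proof (rule psubset_card_mono)
    \<comment> \<open>Transitivity gives the inclusion of in-neighbourhoods, and \<open>x\<close>
      itself makes it strict.\<close>
    have "x \<notin> {z \<in> S. (z, x) \<in> E}" using assms(3) by (auto dest: asymD)
    then show "{z \<in> S. (z, x) \<in> E} \<subset> {z \<in> S. (z, y) \<in> E}"
      using that assms(2) unfolding trans_on_def by blast
  qed (use assms(1) in simp)
  have iff: "(x, y) \<in> E \<longleftrightarrow> rank x < rank y" if "x \<in> S" "y \<in> S" for x y
    using mono that assms(4) unfolding total_on_def by (metis less_asym less_irrefl)
  have inj: "inj_on rank S"
    using iff assms(4) unfolding total_on_def inj_on_def by (metis less_irrefl)
  have "rank x < card S" if "x \<in> S" for x
    unfolding rank_def using that assms(1,3) by (intro psubset_card_mono) (auto dest: asymD)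
  then have "rank ` S = {..<card S}"
    using inj by (intro card_subset_eq) (auto simp: card_image)
  then have bij: "bij_betw rank S {..<card S}" using inj by (simp add: bij_betw_def)
  show thesis
  proof
    show "bij_betw (the_inv_into S rank) {..<card S} S" by (rule bij_betw_the_inv_into[OF bij])
    show "(the_inv_into S rank i, the_inv_into S rank j) \<in> E \<longleftrightarrow> i < j"
      if "i < card S" "j < card S" for i j
      using that bij iff f_the_inv_into_f_bij_betw[OF bij]
        bij_betw_apply[OF bij_betw_the_inv_into[OF bij]] by simp
  qed
qed

lemma pair_wf_transitive_tournament: "pair_wf_digraph (transitive_tournament k)"
  by unfold_locales (auto simp: transitive_tournament_def)

text \<open>It has two uses: to turn a transitive vertex set into a subgraph that can witness
  \<open>copy_in\<close>, and to cut a bare relation down to a well-formed digraph on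
  \<open>S\<close>.\<close>

definition induced_on :: "'a pair_pre_digraph \<Rightarrow> 'a set \<Rightarrow> 'a pair_pre_digraph" where
  "induced_on G S = \<lparr>pverts = S, parcs = parcs G \<inter> S \<times> S\<rparr>"

lemma induced_on_simps [simp]:
  "pverts (induced_on G S) = S" "parcs (induced_on G S) = parcs G \<inter> S \<times> S"
  by (simp_all add: induced_on_def)

lemma subgraph_induced_on:
  assumes "pair_wf_digraph G" and "S \<subseteq> pverts G"
  shows "subgraph (with_proj (induced_on G S)) (with_proj G)"
proof -
  have "pair_wf_digraph (induced_on G S)" by unfold_locales auto
  then show ?thesis using assms by (auto simp: subgraph_def compatible_def wf_digraph_wp_iff)
qed

text \<open>The enumeration of \<open>S\<close> along its transitive order is an isomorphism from
  the standard transitive tournament, whose arcs go from smaller to larger numbers.\<close>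

lemma copy_in_induced_on:
  assumes "pair_wf_digraph G" and "asym (parcs G)" and "S \<subseteq> pverts G" and "finite S"
    and "total_on S (parcs G)" and "trans_on S (parcs G)"
  shows "copy_in (transitive_tournament (card S)) (induced_on G S) G"
proof -
  obtain h where h: "bij_betw h {..<card S} S"
    "\<And>i j. i < card S \<Longrightarrow> j < card S \<Longrightarrow> (h i, h j) \<in> parcs G \<longleftrightarrow> i < j"
    using transitive_set_enumeration[OF assms(4,6,2,5)] by blast
  have S: "S = h ` {..<card S}" using h(1) by (simp add: bij_betw_def)
  have "parcs G \<inter> S \<times> S = map_prod h h ` {(i, j). i < j \<and> j < card S}"
  proof (intro equalityI subsetI)
    fix e assume "e \<in> parcs G \<inter> S \<times> S"
    then obtain i j where "i < card S" "j < card S" "e = (h i, h j)" "(h i, h j) \<in> parcs G"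
      using S by (smt (verit) IntE SigmaE imageE lessThan_iff)
    then show "e \<in> map_prod h h ` {(i, j). i < j \<and> j < card S}"
      using h(2) by auto
  next
    fix e assume "e \<in> map_prod h h ` {(i, j). i < j \<and> j < card S}"
    then obtain i j where ij: "i < j" "j < card S" "e = (h i, h j)" by auto
    then have "h i \<in> S" "h j \<in> S" using bij_betw_apply[OF h(1)] by auto
    then show "e \<in> parcs G \<inter> S \<times> S" using ij h(2) by auto
  qed
  then have "digraph_iso (with_proj (transitive_tournament (card S))) (with_proj (induced_on G S))"
    using h(1) S pair_wf_transitive_tournament
    by (intro digraph_iso_with_projI[of _ h]) (simp_all add: transitive_tournament_def bij_betw_def)
  then show ?thesis unfolding copy_in_def using subgraph_induced_on assms(1,3) by blast
qed

lemma copy_in_transitive_tournamentD: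
  assumes "copy_in (transitive_tournament k) H G" and "asym (parcs G)"
  shows "pverts H \<subseteq> pverts G" and "card (pverts H) = k" and "trans_on (pverts H) (parcs G)"
proof -
  have sub: "pverts H \<subseteq> pverts G" "parcs H \<subseteq> parcs G"
    using assms(1) by (auto simp: copy_in_def subgraph_def)
  obtain h where h: "inj_on h {..<k}" "pverts H = h ` {..<k}"
    "parcs H = map_prod h h ` {(i, j). i < j \<and> j < k}"
    using assms(1) unfolding copy_in_def
    by (auto elim!: digraph_iso_with_projE simp: transitive_tournament_def)
  show "pverts H \<subseteq> pverts G" by fact
  show "card (pverts H) = k" using h by (simp add: card_image)
  have arc: "(h i, h j) \<in> parcs G" if "i < j" "j < k" for i j
    using that h(3) sub(2) by force
  \<comment> \<open>A copy is a subgraph, not necessarily an induced one, so \<open>G\<close> might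
    have further arcs inside it. Such an arc would be a loop or the reverse of an arc of the copy,
    against asymmetry.\<close>
  have "i < j" if "(h i, h j) \<in> parcs G" "i < k" "j < k" for i j
    using that arc[of j i] assms(2) by (metis asymD linorder_neqE_nat)
  then show "trans_on (pverts H) (parcs G)"
    unfolding trans_on_def h(2) using arc by (smt (verit) imageE lessThan_iff order_less_trans)
qed

section \<open>Orientations of complete graphs\<close>

text \<open>Antisymmetry without loops gives \<open>asym\<close>, and adjacency of all distinct
  vertices in \<open>K\<close> gives \<open>total_on\<close>. The combinatorial arguments use
  tournaments only in this relational form.\<close>

lemma orientation_of_completeD:
  assumes "complete_digraph n (with_proj K)" and "orientation_of G K"
  shows "pair_wf_digraph G" and "finite (pverts G)" and "card (pverts G) = n"
    and "asym (parcs G)" and "total_on (pverts G) (parcs G)"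
proof -
  have G: "pair_digraph G" "antisym (parcs G)" "mk_symmetric (with_proj G) = K"
    using assms(2) by (auto simp: orientation_of_def oriented_graph_def)
  interpret pair_digraph G by fact
  show "pair_wf_digraph G" by unfold_locales
  show "finite (pverts G)" by (rule pair_finite_verts)
  have V: "pverts K = pverts G" and arcs: "parcs K = parcs G \<union> (parcs G)\<inverse>"
    using G(3) by (force simp: mk_symmetric_def)+
  show "card (pverts G) = n" using assms(1) V by (simp add: complete_digraph_def)
  show "asym (parcs G)"
    using G(2) pair_no_loops by (fastforce intro!: asymI dest: antisymD)
  have "parcs K = {(u, v). (u, v) \<in> pverts G \<times> pverts G \<and> u \<noteq> v}"
    using assms(1) V by (simp add: complete_digraph_def)
  then show "total_on (pverts G) (parcs G)"
    using arcs unfolding total_on_def by blast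
qed

text \<open>The way back: the symmetric closure of a total loop-free relation is a complete graph,
  so the Ramsey property becomes applicable to tournaments given as relations.\<close>

lemma orientation_of_completeI:
  assumes "pair_wf_digraph G" and "finite (pverts G)"
    and "asym (parcs G)" and "total_on (pverts G) (parcs G)"
  shows "complete_digraph (card (pverts G)) (with_proj (mk_symmetric (with_proj G)))"
    and "orientation_of G (mk_symmetric (with_proj G))"
proof -
  interpret pair_wf_digraph G by fact
  let ?K = "mk_symmetric (with_proj G)"
  have sub: "parcs G \<subseteq> pverts G \<times> pverts G" by (auto dest: in_arcsD1 in_arcsD2)
  have fin: "finite (parcs G)" using finite_subset[OF sub] assms(2) by simp
  have noloop: "fst e \<noteq> snd e" if "e \<in> parcs G" for e
    using that assms(3) by (metis asymD prod.collapse)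
  have "pair_digraph G" using assms(2) fin noloop by unfold_locales auto
  then show "orientation_of G ?K"
    using assms(3) by (auto simp: orientation_of_def oriented_graph_def intro!: antisymI dest: asymD)
  have V: "pverts ?K = pverts G" and arcs: "parcs ?K = parcs G \<union> (parcs G)\<inverse>"
    by (force simp: mk_symmetric_def)+
  have "pair_graph ?K"
  proof unfold_locales
    show "symmetric (with_proj ?K)" unfolding symmetric_def by (auto simp: arcs intro!: symI)
  qed (use V arcs assms(2) fin noloop sub in \<open>auto, fastforce+\<close>)
  then have "graph (with_proj ?K)" by (rule pair_graph.pair_graphD_graph)
  moreover have "parcs ?K = {(u, v). (u, v) \<in> pverts G \<times> pverts G \<and> u \<noteq> v}"
    using arcs sub noloop assms(4) unfolding total_on_def by fastforce
  ultimately show "complete_digraph (card (pverts G)) (with_proj ?K)"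
    using V by (simp add: complete_digraph_def)
qed

text \<open>\<open>LEAST\<close> has its defining property only if some number has it; here
  \<open>2 ^ k\<close> does.\<close>

lemma oriented_Ramsey_property:
  "0 < oriented_Ramsey k \<and>
    (\<forall>K G :: nat pair_pre_digraph. complete_digraph (oriented_Ramsey k) (with_proj K) \<longrightarrow>
      orientation_of G K \<longrightarrow> (\<exists>H. copy_in (transitive_tournament k) H G))"
  unfolding oriented_Ramsey_def
proof (rule LeastI[of _ "2 ^ k"], intro conjI allI impI)
  fix K G :: "nat pair_pre_digraph"
  assume KG: "complete_digraph (2 ^ k) (with_proj K)" "orientation_of G K"
  note G = orientation_of_completeD[OF KG]
  obtain S where S: "S \<subseteq> pverts G" "card S = k" "trans_on S (parcs G)"
    using large_tournament_has_transitive_set[OF G(5,4)] G(3) by (metis order_refl)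
  have "copy_in (transitive_tournament (card S)) (induced_on G S) G"
    using S G finite_subset total_on_subset by (intro copy_in_induced_on) blast+
  then show "\<exists>H. copy_in (transitive_tournament k) H G" using S(2) by blast
qed simp

lemma oriented_Ramsey_pos: "0 < oriented_Ramsey k"
  using oriented_Ramsey_property by blast

text \<open>The Ramsey property concerns tournaments with exactly \<open>oriented_Ramsey k\<close>
  vertices, so it is applied to the subtournament on a subset \<open>W\<close> of that size.\<close>

lemma oriented_Ramsey_transitive_set:
  fixes V :: "nat set"
  assumes "total_on V E" and "asym E" and "oriented_Ramsey k \<le> card V"
  obtains S where "S \<subseteq> V" "card S = k" "trans_on S E"
proof -
  obtain W where W: "W \<subseteq> V" "card W = oriented_Ramsey k" "finite W"
    using assms(3) by (meson obtain_subset_with_card_n)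
  define G where "G = induced_on \<lparr>pverts = W, parcs = E\<rparr> W"
  have wf: "pair_wf_digraph G" unfolding G_def by unfold_locales auto
  have asy: "asym (parcs G)" using assms(2) by (auto simp: G_def intro!: asymI dest: asymD)
  have "total_on (pverts G) (parcs G)"
    using assms(1) W(1) by (auto simp: G_def total_on_def)
  then obtain H where H: "copy_in (transitive_tournament k) H G"
    using orientation_of_completeI[OF wf _ asy] oriented_Ramsey_property[of k] W(2,3)
    by (metis G_def induced_on_simps(1))
  note D = copy_in_transitive_tournamentD[OF H asy]
  have HW: "pverts H \<subseteq> W" using D(1) by (simp add: G_def)
  have "trans_on (pverts H) (E \<inter> W \<times> W)" using D(3) by (simp add: G_def)
  have "trans_on (pverts H) E"
  proof (rule trans_onI)
    fix x y z assume "x \<in> pverts H" "y \<in> pverts H" "z \<in> pverts H" "(x, y) \<in> E" "(y, z) \<in> E"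
    then show "(x, z) \<in> E"
      using HW trans_onD[OF \<open>trans_on (pverts H) (E \<inter> W \<times> W)\<close>, of x y z] by blast
  qed
  moreover have "pverts H \<subseteq> V" using HW W(1) by (rule order_trans)
  ultimately show thesis using that D(2) by blast
qed

section \<open>Tilings by transitive sets\<close>

text \<open>A perfect packing stripped of its digraphs: the tiles are plain vertex sets, so that
  tilings can be joined by set operations.\<close>

definition transitive_tiling :: "'a rel \<Rightarrow> nat \<Rightarrow> 'a set \<Rightarrow> bool" where
  "transitive_tiling E k X \<longleftrightarrow>
    (\<exists>P. (\<forall>A\<in>P. card A = k \<and> trans_on A E) \<and> disjoint P \<and> \<Union>P = X)"

lemma transitive_tiling_empty: "transitive_tiling E k {}"
  unfolding transitive_tiling_def by (intro exI[of _ "{}"]) auto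

lemma transitive_tiling_single:
  assumes "trans_on A E" and "card A = k"
  shows "transitive_tiling E k A"
  unfolding transitive_tiling_def using assms by (intro exI[of _ "{A}"]) auto

lemma transitive_tiling_Un:
  assumes "transitive_tiling E k X" and "transitive_tiling E k Y" and "X \<inter> Y = {}"
  shows "transitive_tiling E k (X \<union> Y)"
proof -
  obtain P where P: "\<forall>A\<in>P. card A = k \<and> trans_on A E" "disjoint P" "\<Union>P = X"
    using assms(1) unfolding transitive_tiling_def by blast
  obtain Q where Q: "\<forall>A\<in>Q. card A = k \<and> trans_on A E" "disjoint Q" "\<Union>Q = Y"
    using assms(2) unfolding transitive_tiling_def by blast
  have "disjoint (P \<union> Q)" using P Q assms(3) by (intro disjoint_union) auto
  then show ?thesis unfolding transitive_tiling_def using P Q by (intro exI[of _ "P \<union> Q"]) auto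
qed

lemma transitive_tiling_absorb_vertex:
  assumes "trans_on A E" and "asym E" and "total_on (insert v A) E"
    and "card A = 2 * k - 1" and "k > 0" and "v \<notin> A"
  shows "transitive_tiling E k (insert v A)"
proof -
  have fin: "finite A" using assms(4,5) by (intro card_ge_0_finite) linarith
  obtain N where N: "N \<subseteq> A" "k \<le> card N"
    "(\<forall>x\<in>N. (v, x) \<in> E) \<or> (\<forall>x\<in>N. (x, v) \<in> E)"
    using card_large_neighbourhood[OF assms(3,6,4) fin] by blast
  \<comment> \<open>With \<open>k - 1\<close> vertices in \<open>B\<close> both tiles get the right
    size: \<open>B\<close> together with \<open>v\<close> has \<open>k\<close> vertices, and
    \<open>2 * k - 1 - (k - 1) = k\<close> are left in \<open>A\<close>.\<close>
  obtain B where B: "B \<subseteq> N" "card B = k - 1" "finite B"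
    using obtain_subset_with_card_n[OF order_trans[OF diff_le_self N(2)]] by metis
  have sub: "B \<subseteq> A" "A - B \<subseteq> A" using B(1) N(1) by auto
  have "trans_on (insert v B) E"
    using sub(1) B(1) N(3) assms(1,2) by (intro trans_on_insert) (auto intro: trans_on_subset)
  moreover have "card (insert v B) = k" using B sub(1) assms(5,6) by (subst card_insert_disjoint) auto
  moreover have "card (A - B) = k" using sub(1) B assms(4,5) by (simp add: card_Diff_subset)
  moreover have "trans_on (A - B) E" using assms(1) sub(2) by (rule trans_on_subset)
  ultimately have "transitive_tiling E k (insert v B \<union> (A - B))"
    using assms(6) by (intro transitive_tiling_Un transitive_tiling_single) auto
  moreover have "insert v B \<union> (A - B) = insert v A" using sub(1) by auto
  ultimately show ?thesis by simp
qed

text \<open>Any absorber takes in any vertex, so an arbitrary one-to-one matching of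
  \<open>U\<close> with \<open>L\<close> works; the induction builds it one pair at a time.\<close>

lemma transitive_tiling_absorb_equal:
  assumes "finite U" and "finite L" and "card U = card L" and "disjoint L" and "U \<inter> \<Union>L = {}"
    and "\<And>A. A \<in> L \<Longrightarrow> card A = 2 * k - 1 \<and> trans_on A E"
    and "asym E" and "total_on (U \<union> \<Union>L) E" and "k > 0"
  shows "transitive_tiling E k (U \<union> \<Union>L)"
  using assms(1-6,8)
proof (induction U arbitrary: L rule: finite_induct)
  case empty
  then show ?case by (simp add: transitive_tiling_empty)
next
  case (insert v U)
  then obtain A where A: "A \<in> L" by (metis card.insert card_eq_0_iff ex_in_conv nat.distinct(1))
  let ?L = "L - {A}"
  have L: "L = insert A ?L" using A by auto
  have disj: "A \<inter> \<Union>?L = {}" using insert.prems(3) A unfolding disjoint_def by blast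
  have "transitive_tiling E k (U \<union> \<Union>?L)"
  proof (rule insert.IH)
    show "card U = card ?L" using insert.prems(2) insert.hyps A insert.prems(1) by simp
    show "disjoint ?L" using insert.prems(3) by (auto simp: disjoint_def)
    show "total_on (U \<union> \<Union>?L) E" using insert.prems(6) by (rule total_on_subset) auto
  qed (use insert.prems in auto)
  moreover have "transitive_tiling E k (insert v A)"
  proof (rule transitive_tiling_absorb_vertex)
    show "total_on (insert v A) E" using insert.prems(6) by (rule total_on_subset) (use A in auto)
  qed (use A insert.prems assms(7,9) in auto)
  moreover have "insert v A \<inter> (U \<union> \<Union>?L) = {}"
    using disj insert.prems(4) insert.hyps A by auto
  ultimately have "transitive_tiling E k (insert v A \<union> (U \<union> \<Union>?L))"
    by (metis transitive_tiling_Un)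
  moreover have "insert v A \<union> (U \<union> \<Union>?L) = insert v U \<union> \<Union>L" using A by auto
  ultimately show ?case by simp
qed

text \<open>Induction on the surplus: breaking up one absorber yields a tile and
  \<open>k - 1\<close> further vertices to absorb. There is then one absorber fewer and
  \<open>k - 1\<close> vertices more, so the surplus drops by exactly \<open>k\<close>.\<close>

lemma transitive_tiling_absorb:
  assumes "finite U" and "finite L" and "card L = card U + k * t"
    and "disjoint L" and "U \<inter> \<Union>L = {}"
    and "\<And>A. A \<in> L \<Longrightarrow> card A = 2 * k - 1 \<and> trans_on A E"
    and "asym E" and "total_on (U \<union> \<Union>L) E" and "k > 0"
  shows "transitive_tiling E k (U \<union> \<Union>L)"
  using assms(1-6,8)
proof (induction t arbitrary: U L)
  case 0
  then show ?case using assms(7,9) by (intro transitive_tiling_absorb_equal) auto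
next
  case (Suc t)
  have "L \<noteq> {}" using Suc.prems(3) assms(9) by auto
  then obtain A where A: "A \<in> L" by auto
  have cA: "card A = 2 * k - 1" "trans_on A E" using Suc.prems(6) A by auto
  have "k \<le> card A" using cA(1) assms(9) by linarith
  then obtain B where B: "B \<subseteq> A" "card B = k" "finite B"
    by (rule obtain_subset_with_card_n)
  let ?L = "L - {A}" and ?U = "U \<union> (A - B)"
  have finA: "finite A" using cA(1) assms(9) by (intro card_ge_0_finite) linarith
  have disj: "A \<inter> \<Union>?L = {}" using Suc.prems(4) A unfolding disjoint_def by blast
  have UA: "U \<inter> A = {}" using Suc.prems(5) A by auto
  have "card ?U = card U + (k - 1)"
    using UA Suc.prems(1) finA B cA(1) assms(9) by (subst card_Un_disjoint) (auto simp: card_Diff_subset)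
  have "transitive_tiling E k (?U \<union> \<Union>?L)"
  proof (rule Suc.IH)
    show "card ?L = card ?U + k * t"
      using \<open>card ?U = _\<close> Suc.prems(2,3) A assms(9) by (simp add: card_Diff_singleton)
    show "disjoint ?L" using Suc.prems(4) by (auto simp: disjoint_def)
    show "total_on (?U \<union> \<Union>?L) E" using Suc.prems(7) by (rule total_on_subset) (use A in auto)
  qed (use Suc.prems finA disj A in auto)
  moreover have "transitive_tiling E k B"
    using B cA(2) by (intro transitive_tiling_single) (auto intro: trans_on_subset)
  moreover have "B \<inter> (?U \<union> \<Union>?L) = {}" using B(1) UA disj by auto
  ultimately have "transitive_tiling E k (B \<union> (?U \<union> \<Union>?L))"
    by (metis transitive_tiling_Un)
  moreover have "B \<union> (?U \<union> \<Union>?L) = U \<union> \<Union>L" using A B(1) by auto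
  ultimately show ?case by simp
qed

text \<open>Each chosen set uses up \<open>s\<close> vertices, so before each of the
  \<open>m\<close> choices at least \<open>N\<close> vertices are still free.\<close>

lemma greedy_disjoint_transitive_sets:
  assumes "finite V" and "N + s * m \<le> card V" and "s > 0"
    and "\<And>X. X \<subseteq> V \<Longrightarrow> N \<le> card X \<Longrightarrow> \<exists>S\<subseteq>X. card S = s \<and> trans_on S E"
  shows "\<exists>L. finite L \<and> card L = m \<and> disjoint L \<and> \<Union>L \<subseteq> V \<and>
    (\<forall>A\<in>L. card A = s \<and> trans_on A E)"
  using assms(2)
proof (induction m)
  case 0
  then show ?case by (intro exI[of _ "{}"]) auto
next
  case (Suc m)
  have "N + s * m \<le> card V" using Suc.prems by simp
  from Suc.IH[OF this] obtain L where L: "finite L" "card L = m" "disjoint L" "\<Union>L \<subseteq> V"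
    "\<forall>A\<in>L. card A = s \<and> trans_on A E" by blast
  have "card (\<Union>L) \<le> sum card L" by (rule card_Union_le_sum_card)
  also have "\<dots> = s * m" using L by simp
  finally have "N \<le> card (V - \<Union>L)"
    using Suc.prems diff_card_le_card_Diff[of "\<Union>L" V] finite_subset[OF L(4) assms(1)] by simp
  then obtain S where S: "S \<subseteq> V - \<Union>L" "card S = s" "trans_on S E"
    using assms(4)[of "V - \<Union>L"] by blast
  \<comment> \<open>A nonempty set disjoint from \<open>\<Union>L\<close> cannot be a member of
    \<open>L\<close>, so the family really grows by one.\<close>
  have "S \<noteq> {}" using S(2) assms(3) by auto
  then have "S \<notin> L" using S(1) by blast
  moreover have "disjoint (insert S L)" using L(3) S(1) unfolding disjoint_def by blast
  ultimately show ?case using L S by (intro exI[of _ "insert S L"]) auto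
qed

text \<open>Tiles are removed while at least \<open>N\<close> vertices remain; since
  \<open>k > 0\<close>, each removal leaves a proper subset, to which the induction applies.\<close>

lemma greedy_transitive_tiling:
  assumes "finite X" and "k > 0"
    and "\<And>Y. Y \<subseteq> X \<Longrightarrow> N \<le> card Y \<Longrightarrow> \<exists>S\<subseteq>Y. card S = k \<and> trans_on S E"
  shows "\<exists>U\<subseteq>X. card U < N \<and> transitive_tiling E k (X - U)"
  using assms(1,3)
proof (induction X rule: finite_psubset_induct)
  case (psubset X)
  show ?case
  proof (cases "card X < N")
    case True
    then show ?thesis by (intro exI[of _ X]) (simp add: transitive_tiling_empty)
  next
    case False
    then obtain S where S: "S \<subseteq> X" "card S = k" "trans_on S E"
      using psubset.prems[of X] by auto
    then have "X - S \<subset> X" using assms(2) by (cases "S = {}") auto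
    moreover have "\<exists>S\<subseteq>Y. card S = k \<and> trans_on S E" if "Y \<subseteq> X - S" "N \<le> card Y" for Y
      using that psubset.prems by blast
    ultimately obtain U where U: "U \<subseteq> X - S" "card U < N" "transitive_tiling E k (X - S - U)"
      using psubset.IH[of "X - S"] by blast
    have "transitive_tiling E k (S \<union> (X - S - U))"
      using transitive_tiling_single[OF S(3,2)] U(3) by (intro transitive_tiling_Un) auto
    moreover have "S \<union> (X - S - U) = X - U" using S(1) U(1) by auto
    ultimately show ?thesis using U by (intro exI[of _ U]) auto
  qed
qed

lemma transitive_tiling_card_dvd:
  assumes "transitive_tiling E k X" and "finite X"
  shows "k dvd card X"
proof -
  obtain P where P: "\<forall>A\<in>P. card A = k \<and> trans_on A E" "disjoint P" "\<Union>P = X"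
    using assms(1) unfolding transitive_tiling_def by blast
  have "card (\<Union>P) = sum card P"
    using P assms(2) by (intro card_Union_disjoint) (auto intro: finite_subset)
  then show ?thesis using P by simp
qed

lemma large_tournament_has_transitive_tiling:
  fixes V :: "nat set"
  assumes "finite V" and "total_on V E" and "asym E" and "k > 0" and "k dvd card V"
    and "oriented_Ramsey (2 * k - 1) + (2 * k - 1) * (oriented_Ramsey k - 1) \<le> card V"
  shows "transitive_tiling E k V"
proof -
  \<comment> \<open>The greedy tiling leaves fewer than \<open>oriented_Ramsey k\<close> vertices,
    so \<open>?m\<close> absorbers suffice, one for each of them.\<close>
  let ?s = "2 * k - 1" and ?m = "oriented_Ramsey k - 1"
  have ramsey: "\<exists>S\<subseteq>X. card S = j \<and> trans_on S E"
    if "X \<subseteq> V" "oriented_Ramsey j \<le> card X" for X j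
    using oriented_Ramsey_transitive_set[OF total_on_subset[OF assms(2) that(1)] assms(3) that(2)]
    by metis
  obtain L where L: "finite L" "card L = ?m" "disjoint L" "\<Union>L \<subseteq> V"
    "\<forall>A\<in>L. card A = ?s \<and> trans_on A E"
    using greedy_disjoint_transitive_sets[OF assms(1,6) _ ramsey] assms(4) by auto
  obtain U where U: "U \<subseteq> V - \<Union>L" "card U < oriented_Ramsey k"
    "transitive_tiling E k (V - \<Union>L - U)"
  proof -
    have "\<exists>U\<subseteq>V - \<Union>L. card U < oriented_Ramsey k \<and> transitive_tiling E k (V - \<Union>L - U)"
      using assms(1,4) ramsey by (intro greedy_transitive_tiling) blast+
    then show thesis using that by blast
  qed
  have finU: "finite U" using U(1) assms(1) finite_subset by blast
  have cL: "card (\<Union>L) = ?s * ?m"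
  proof -
    have "card (\<Union>L) = sum card L"
      using L(3,4) assms(1) by (intro card_Union_disjoint) (auto intro: finite_subset)
    then show ?thesis using L(2,5) by simp
  qed
  have dvd: "k dvd card (V - \<Union>L - U)"
    using transitive_tiling_card_dvd[OF U(3)] assms(1) by simp
  have "card V = card (V - \<Union>L - U) + card (U \<union> \<Union>L)"
  proof -
    have "V = (V - \<Union>L - U) \<union> (U \<union> \<Union>L)" using U(1) L(4) by auto
    moreover have "card ((V - \<Union>L - U) \<union> (U \<union> \<Union>L)) = card (V - \<Union>L - U) + card (U \<union> \<Union>L)"
      using finite_subset[OF L(4) assms(1)] finU assms(1) by (intro card_Un_disjoint) auto
    ultimately show ?thesis by simp
  qed
  also have "card (U \<union> \<Union>L) = card U + ?s * ?m"
    using card_Un_disjoint[OF finU finite_subset[OF L(4) assms(1)]] U(1) cL by auto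
  finally have "k dvd card U + ?s * ?m"
    using assms(5) dvd by (metis dvd_add_right_iff)
  \<comment> \<open>Modulo \<open>k\<close> an absorber counts as -1, so \<open>k\<close> divides
    the surplus of absorbers over leftover vertices. Adding that surplus to the vertex count
    expresses this without negative numbers.\<close>
  moreover have "card U + ?s * ?m + (?m - card U) = k * (2 * ?m)"
  proof -
    have "?s * m + m = k * (2 * m)" for m using assms(4) by (cases k) (simp_all add: algebra_simps)
    from this[of ?m] show ?thesis using U(2) by linarith
  qed
  ultimately have "k dvd ?m - card U"
    by (metis dvd_add_right_iff dvd_triv_left)
  then obtain t where t: "?m - card U = k * t" by (elim dvdE)
  have "transitive_tiling E k (U \<union> \<Union>L)"
  proof (rule transitive_tiling_absorb)
    show "card L = card U + k * t" using t L(2) U(2) by linarith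
    show "total_on (U \<union> \<Union>L) E" using assms(2) by (rule total_on_subset) (use U(1) L(4) in auto)
  qed (use L U(1) finU assms(3,4) in auto)
  then have "transitive_tiling E k ((U \<union> \<Union>L) \<union> (V - \<Union>L - U))"
    by (rule transitive_tiling_Un[OF _ U(3)]) auto
  moreover have "(U \<union> \<Union>L) \<union> (V - \<Union>L - U) = V" using U(1) L(4) by auto
  ultimately show ?thesis by simp
qed

text \<open>Each tile is replaced by the subgraph it induces, which is a copy of the transitive
  tournament.\<close>

lemma perfect_packing_of_transitive_tiling:
  assumes "pair_wf_digraph G" and "finite (pverts G)" and "asym (parcs G)"
    and "total_on (pverts G) (parcs G)" and "transitive_tiling (parcs G) k (pverts G)"
  shows "\<exists>P. perfect_packing (transitive_tournament k) P G"
proof -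
  obtain P where P: "\<forall>A\<in>P. card A = k \<and> trans_on A (parcs G)" "disjoint P" "\<Union>P = pverts G"
    using assms(5) unfolding transitive_tiling_def by blast
  have "copy_in (transitive_tournament k) (induced_on G A) G" if "A \<in> P" for A
  proof -
    have "A \<subseteq> pverts G" using that P(3) by auto
    then have "copy_in (transitive_tournament (card A)) (induced_on G A) G"
      using assms P(1) that finite_subset total_on_subset by (intro copy_in_induced_on) blast+
    then show ?thesis using P(1) that by simp
  qed
  then have "perfect_packing (transitive_tournament k) (induced_on G ` P) G"
    using P(2,3) unfolding perfect_packing_def pairwise_def disjnt_def by fastforce
  then show ?thesis by blast
qed

theorem proposition10:
  fixes k :: nat
  assumes "k > 0"
  shows "oriented_tiling_Ramsey k \<le>
    oriented_Ramsey (2 * k - 1) + (2 * k - 1) * oriented_Ramsey k"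
proof -
  let ?M = "oriented_Ramsey (2 * k - 1) + (2 * k - 1) * oriented_Ramsey k"
  \<comment> \<open>The largest multiple of \<open>k\<close> not exceeding \<open>?M\<close>; the
    tiling Ramsey number ranges over multiples of \<open>k\<close> only.\<close>
  define n where "n = k * (?M div k)"
  have "?M < n + k"
    unfolding n_def using mult_div_mod_eq[of k ?M] mod_less_divisor[OF assms, of ?M] by linarith
  \<comment> \<open>Rounding down to \<open>n\<close> costs fewer than \<open>k\<close> vertices.
    Only \<open>oriented_Ramsey k - 1\<close> absorbers are set aside, and the remaining
    \<open>2 * k - 1\<close> vertices of the bound cover this loss.\<close>
  moreover have "(2 * k - 1) * oriented_Ramsey k =
      (2 * k - 1) * (oriented_Ramsey k - 1) + (2 * k - 1)"
    using oriented_Ramsey_pos[of k] by (cases "oriented_Ramsey k") auto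
  ultimately have n: "oriented_Ramsey (2 * k - 1) + (2 * k - 1) * (oriented_Ramsey k - 1) \<le> n"
    using assms by linarith
  have "oriented_tiling_Ramsey k \<le> n"
    unfolding oriented_tiling_Ramsey_def
  proof (rule Least_le, intro conjI allI impI)
    show "0 < n" using n oriented_Ramsey_pos[of "2 * k - 1"] by linarith
    show "k dvd n" by (simp add: n_def)
    fix K G :: "nat pair_pre_digraph"
    assume KG: "complete_digraph n (with_proj K)" "orientation_of G K"
    note G = orientation_of_completeD[OF KG]
    have "transitive_tiling (parcs G) k (pverts G)"
      using G n assms by (intro large_tournament_has_transitive_tiling) (auto simp: n_def)
    then show "\<exists>\<P>. perfect_packing (transitive_tournament k) \<P> G"
      using G by (intro perfect_packing_of_transitive_tiling)
  qed
  also have "n \<le> ?M" by (simp add: n_def)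
  finally show ?thesis .
qed

end
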